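(* Let $F:\mathbb{R}\to\mathbb{R}$ be a differentiable function and $f=F'$. Then $G_f=\{T,R,\tilde X,\tilde Y\}$, where $$T=\frac{\partial}{\partial t},\quad R=y\frac{\partial}{\partial x}-x\frac{\partial}{\partial y},\quad \tilde X=\frac{\partial}{\partial x}-2y\frac{\partial}{\partial t},\quad \tilde Y=\frac{\partial}{\partial y}+2x\frac{\partial}{\partial t},$$ is a Noether symmetry group of the equation $\Delta_{H^1}u+f(u)=0$, for any function $f$; that is, every vector field in the Lie algebra generated by $T,R,\tilde X,\tilde Y$ is a Noether symmetry of this equation.
   Context: Coordinates on $\mathbb{R}^3$ (the Heisenberg group $H^1$) are $(x^1,x^2,x^3)=(x,y,t)$, and $u=u(x,y,t)$ is a smooth real-valued function. The Kohn-Laplace operator is $$\Delta_{H^1}u=u_{xx}+u_{yy}+4(x^2+y^2)u_{tt}+4y\,u_{xt}-4x\,u_{yt}.$$ The equation $\Delta_{H^1}u+f(u)=0$, with $f=F'$, is the Euler-Lagrange equation of the Lagrangian $$\mathcal{L}=\tfrac12u_x^2+\tfrac12u_y^2+2(x^2+y^2)u_t^2+2y\,u_xu_t-2x\,u_yu_t-F(u).$$ A Lie point symmetry is a vector field $S=\xi^i(x,y,t,u)\frac{\partial}{\partial x^i}+\eta(x,y,t,u)\frac{\partial}{\partial u}$ (sum over $i=1,2,3$) whose second prolongation annihilates $\Delta_{H^1}u+f(u)$ whenever $\Delta_{H^1}u+f(u)=0$. Its first prolongation is $S^{(1)}=S+\eta^{(1)}_i\frac{\partial}{\partial u_i}$,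 $\eta^{(1)}_i=D_i\eta-(D_i\xi^j)u_j$, where $D_i$ is the total derivative with respect to $x^i$ and $u_i=\partial u/\partial x^i$. A Lie point symmetry $S$ is a Noether symmetry if there exists $\varphi=(\varphi^1,\varphi^2,\varphi^3)$, with components functions of $x,y,t,u$ and derivatives of $u$, such that $S^{(1)}\mathcal{L}+\mathcal{L}\,D_i\xi^i=D_i\varphi^i$ identically. Symmetry groups are identified with the infinitesimal generators that generate them. *)

theory Defs
  imports "HOL-Analysis.Analysis" "HOL-Library.Multiset"
begin

text \<open>
  A point of the infinite jet space of functions \<open>u(x,y,t)\<close> is a pair \<open>(x, U)\<close> of a base point
  and the values \<open>U J\<close> of the derivatives \<open>u\<^sub>J\<close>, where the multiset \<open>J\<close> lists the indices of
  differentiation: \<open>U {#}\<close> stands for \<open>u\<close>, \<open>U {#i#}\<close> for \<open>u\<^sub>i\<close>, \<open>U {#i, j#}\<close> for \<open>u\<^sub>i\<^sub>j\<close>.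
  The coordinates \<open>(x, y, t)\<close> are the components \<open>1, 2, 3\<close>; note that \<open>3 = 0\<close> in the index type.
\<close>

type_synonym jet = "(real^3) \<times> (3 multiset \<Rightarrow> real)"

definition jet_line :: "jet \<Rightarrow> jet \<Rightarrow> real \<Rightarrow> jet" where
  "jet_line p v s = (fst p + s *\<^sub>R fst v, \<lambda>J. snd p J + s * snd v J)"

definition has_jet_deriv :: "(jet \<Rightarrow> real) \<Rightarrow> jet \<Rightarrow> jet \<Rightarrow> real \<Rightarrow> bool" where
  "has_jet_deriv h v p D \<longleftrightarrow> ((\<lambda>s. h (jet_line p v s)) has_real_derivative D) (at 0)"

definition jet_deriv :: "(jet \<Rightarrow> real) \<Rightarrow> jet \<Rightarrow> jet \<Rightarrow> real" where
  "jet_deriv h v p = deriv (\<lambda>s. h (jet_line p v s)) 0"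

text \<open>
  Continuity refers to the product topology. For a function of finitely many jet coordinates,
  \<open>jet_Ck k\<close> is the usual class \<open>C\<^sup>k\<close>: all iterated directional derivatives up to order \<open>k\<close>
  exist and are continuous.
\<close>

primrec jet_Ck :: "nat \<Rightarrow> (jet \<Rightarrow> real) \<Rightarrow> bool" where
  "jet_Ck 0 h \<longleftrightarrow> continuous_on UNIV h"
| "jet_Ck (Suc k) h \<longleftrightarrow> continuous_on UNIV h \<and>
     (\<forall>v. (\<forall>p. \<exists>D. has_jet_deriv h v p D) \<and> jet_Ck k (\<lambda>p. jet_deriv h v p))"

definition jet_smooth :: "(jet \<Rightarrow> real) \<Rightarrow> bool" where
  "jet_smooth h \<longleftrightarrow> (\<forall>k. jet_Ck k h)"

definition jet_order_le :: "nat \<Rightarrow> (jet \<Rightarrow> real) \<Rightarrow> bool" where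
  "jet_order_le n h \<longleftrightarrow>
     (\<forall>x U V. (\<forall>J. size J \<le> n \<longrightarrow> U J = V J) \<longrightarrow> h (x, U) = h (x, V))"

text \<open>Smooth functions of \<open>x, y, t, u\<close> and finitely many derivatives of \<open>u\<close>:\<close>

definition differential_function :: "(jet \<Rightarrow> real) \<Rightarrow> bool" where
  "differential_function h \<longleftrightarrow> jet_smooth h \<and> (\<exists>n. jet_order_le n h)"

text \<open>
  The total derivative \<open>D\<^sub>i = \<partial>/\<partial>x\<^sup>i + u\<^sub>i \<partial>/\<partial>u + u\<^sub>i\<^sub>j \<partial>/\<partial>u\<^sub>j + \<dots>\<close>, as the
  derivative along the vector with components \<open>1\<close> at \<open>x\<^sup>i\<close> and \<open>u\<^sub>J\<^sub>i\<close> at \<open>u\<^sub>J\<close>.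
\<close>

definition total_deriv :: "3 \<Rightarrow> (jet \<Rightarrow> real) \<Rightarrow> jet \<Rightarrow> real" where
  "total_deriv i h p = jet_deriv h (axis i 1, \<lambda>J. snd p (add_mset i J)) p"

text \<open>Vector fields \<open>S = \<xi>\<^sup>i \<partial>/\<partial>x\<^sup>i + \<eta> \<partial>/\<partial>u\<close>, given as \<open>(x, u) \<mapsto> (\<xi>, \<eta>)\<close>:\<close>

type_synonym point_field = "(real^3) \<times> real \<Rightarrow> (real^3) \<times> real"

definition xi :: "point_field \<Rightarrow> 3 \<Rightarrow> jet \<Rightarrow> real" where
  "xi S i p = fst (S (fst p, snd p {#})) $ i"

definition eta :: "point_field \<Rightarrow> jet \<Rightarrow> real" where
  "eta S p = snd (S (fst p, snd p {#}))"

definition smooth_field :: "point_field \<Rightarrow> bool" where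
  "smooth_field S \<longleftrightarrow> (\<forall>i. jet_smooth (xi S i)) \<and> jet_smooth (eta S)"

text \<open>
  The coefficients of the prolongations:
  \<open>\<eta>\<^sub>i = D\<^sub>i \<eta> - (D\<^sub>i \<xi>\<^sup>k) u\<^sub>k\<close>, \<open>\<eta>\<^sub>i\<^sub>j = D\<^sub>i \<eta>\<^sub>j - (D\<^sub>i \<xi>\<^sup>k) u\<^sub>k\<^sub>j\<close>, and so on.
\<close>

primrec prolong_coeff :: "point_field \<Rightarrow> 3 list \<Rightarrow> jet \<Rightarrow> real" where
  "prolong_coeff S [] = eta S"
| "prolong_coeff S (i # js) = (\<lambda>p. total_deriv i (prolong_coeff S js) p
     - (\<Sum>k\<in>UNIV. total_deriv i (xi S k) p * snd p (add_mset k (mset js))))"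

text \<open>
  The \<open>n\<close>-th prolongation, as a vector field on the jet space. For smooth fields the
  coefficients are symmetric in the indices, so listing them in sorted order is no restriction.
\<close>

definition prolong :: "nat \<Rightarrow> point_field \<Rightarrow> jet \<Rightarrow> jet" where
  "prolong n S p = ((\<chi> i. xi S i p),
     (\<lambda>J. if size J \<le> n then prolong_coeff S (sorted_list_of_multiset J) p else 0))"

text \<open>
  Symmetries of a second-order equation \<open>H = 0\<close>. The derivative of \<open>H\<close> is required to exist
  only along the prolonged field, because \<open>f\<close> in the equation below need not be differentiable.
\<close>

definition lie_point_symmetry :: "(jet \<Rightarrow> real) \<Rightarrow> point_field \<Rightarrow> bool" where
  "lie_point_symmetry H S \<longleftrightarrow> smooth_field S \<and>
     (\<forall>p. H p = 0 \<longrightarrow> has_jet_deriv H (prolong 2 S p) p 0)"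

definition noether_symmetry :: "(jet \<Rightarrow> real) \<Rightarrow> (jet \<Rightarrow> real) \<Rightarrow> point_field \<Rightarrow> bool" where
  "noether_symmetry L H S \<longleftrightarrow> lie_point_symmetry H S \<and>
     (\<exists>\<phi>. (\<forall>i. differential_function (\<phi> i)) \<and>
        (\<forall>p. \<exists>D. has_jet_deriv L (prolong 1 S p) p D \<and>
           D + L p * (\<Sum>i\<in>UNIV. total_deriv i (xi S i) p) = (\<Sum>i\<in>UNIV. total_deriv i (\<phi> i) p)))"

definition lie_bracket :: "point_field \<Rightarrow> point_field \<Rightarrow> point_field" where
  "lie_bracket V W = (\<lambda>z. frechet_derivative W (at z) (V z) - frechet_derivative V (at z) (W z))"

inductive_set lie_algebra_generated :: "point_field set \<Rightarrow> point_field set"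
  for G :: "point_field set" where
  generator: "V \<in> G \<Longrightarrow> V \<in> lie_algebra_generated G"
| zero: "(\<lambda>z. 0) \<in> lie_algebra_generated G"
| add: "V \<in> lie_algebra_generated G \<Longrightarrow> W \<in> lie_algebra_generated G \<Longrightarrow>
     (\<lambda>z. V z + W z) \<in> lie_algebra_generated G"
| scale: "V \<in> lie_algebra_generated G \<Longrightarrow> (\<lambda>z. c *\<^sub>R V z) \<in> lie_algebra_generated G"
| bracket: "V \<in> lie_algebra_generated G \<Longrightarrow> W \<in> lie_algebra_generated G \<Longrightarrow>
     lie_bracket V W \<in> lie_algebra_generated G"

definition kohn_laplacian :: "jet \<Rightarrow> real" where
  "kohn_laplacian = (\<lambda>(x, U). U {#1, 1#} + U {#2, 2#}
     + 4 * ((x$1)\<^sup>2 + (x$2)\<^sup>2) * U {#3, 3#} + 4 * x$2 * U {#1, 3#} - 4 * x$1 * U {#2, 3#})"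

definition kohn_laplace_equation :: "(real \<Rightarrow> real) \<Rightarrow> jet \<Rightarrow> real" where
  "kohn_laplace_equation f p = kohn_laplacian p + f (snd p {#})"

definition kohn_lagrangian :: "(real \<Rightarrow> real) \<Rightarrow> jet \<Rightarrow> real" where
  "kohn_lagrangian F = (\<lambda>(x, U). 1/2 * (U {#1#})\<^sup>2 + 1/2 * (U {#2#})\<^sup>2
     + 2 * ((x$1)\<^sup>2 + (x$2)\<^sup>2) * (U {#3#})\<^sup>2
     + 2 * x$2 * U {#1#} * U {#3#} - 2 * x$1 * U {#2#} * U {#3#} - F (U {#}))"

definition T_field :: point_field where
  "T_field = (\<lambda>(x, u). (vector [0, 0, 1], 0))"

definition R_field :: point_field where
  "R_field = (\<lambda>(x, u). (vector [x$2, - x$1, 0], 0))"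

definition X_tilde :: point_field where
  "X_tilde = (\<lambda>(x, u). (vector [1, 0, - 2 * x$2], 0))"

definition Y_tilde :: point_field where
  "Y_tilde = (\<lambda>(x, u). (vector [0, 1, 2 * x$1], 0))"

definition G_f :: "point_field set" where
  "G_f = {T_field, R_field, X_tilde, Y_tilde}"

end

(* The Lie algebra generated by the four fields consists of affine fields x \<mapsto> A x + w without
   a component along u, so their prolongations are explicit and linear in the derivatives of u.
   Along the prolonged fields both the Lagrangian and the operator have derivative zero, u itself is
   constant (so f and F do not matter), and trace A = 0; hence \<phi> = 0 is a valid potential. *)
theory Submission
  imports Defs
begin

definition affine_field :: "real^3^3 \<Rightarrow> real^3 \<Rightarrow> point_field" where
  "affine_field A w = (\<lambda>(x, u). (A *v x + w, 0))"

text \<open>Affine functions of the base point are closed under directional derivatives: the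
  derivative along \<open>v\<close> is the constant \<open>inner r (fst v)\<close>. Hence
  \<open>r\<close> and \<open>c\<close> vary in the induction.\<close>

lemma jet_smooth_affine: "jet_smooth (\<lambda>p. inner r (fst p) + c)"
proof -
  have "jet_Ck k (\<lambda>p. inner r (fst p) + c)" for k c r
  proof (induction k arbitrary: r c)
    case 0
    show ?case by (auto intro!: continuous_intros)
  next
    case (Suc k)
    have D: "((\<lambda>s. inner r (fst (jet_line p v s)) + c) has_real_derivative inner r (fst v)) (at 0)"
      for p v
      by (auto simp: jet_line_def inner_add_right intro!: derivative_eq_intros)
    \<comment> \<open>The constant derivative is written with the summand
      \<open>inner 0 (fst p)\<close>, so that the induction hypothesis applies with \<open>r\<close>
      replaced by \<open>0\<close>.\<close>
    have "jet_deriv (\<lambda>p. inner r (fst p) + c) v = (\<lambda>p. inner 0 (fst p) + inner r (fst v))" for v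
      unfolding jet_deriv_def by (simp add: fun_eq_iff DERIV_imp_deriv[OF D])
    moreover have "\<exists>D. has_jet_deriv (\<lambda>p. inner r (fst p) + c) v p D" for v p
      using D unfolding has_jet_deriv_def by blast
    moreover have "continuous_on UNIV (\<lambda>p :: jet. inner r (fst p) + c)"
      by (intro continuous_intros)
    ultimately show ?case
      using Suc.IH by (simp del: inner_zero_left split_paired_All)
  qed
  then show ?thesis by (simp add: jet_smooth_def)
qed

lemma xi_affine_field: "xi (affine_field A w) k = (\<lambda>p. inner (A $ k) (fst p) + w $ k)"
  by (auto simp: xi_def affine_field_def matrix_vector_mult_def inner_vec_def)

lemma eta_affine_field: "eta (affine_field A w) = (\<lambda>p. 0)"
  by (auto simp: eta_def affine_field_def)

lemma smooth_affine_field: "smooth_field (affine_field A w)"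
  using jet_smooth_affine jet_smooth_affine[of 0 0]
  by (auto simp: smooth_field_def xi_affine_field eta_affine_field)

lemma total_deriv_const: "total_deriv i (\<lambda>p. c) p = 0"
  by (simp add: total_deriv_def jet_deriv_def)

lemma total_deriv_xi_affine_field: "total_deriv i (xi (affine_field A w) k) p = A $ k $ i"
  unfolding total_deriv_def jet_deriv_def xi_affine_field
  by (rule DERIV_imp_deriv)
     (auto simp: jet_line_def inner_add_right inner_axis intro!: derivative_eq_intros)

lemma prolong_coeff_affine_field_1:
  "prolong_coeff (affine_field A w) [j] = (\<lambda>p. - (\<Sum>k\<in>UNIV. A $ k $ j * snd p {#k#}))"
  by (simp add: eta_affine_field total_deriv_const total_deriv_xi_affine_field)

text \<open>The coefficients of the field along the base have constant derivatives, so a second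
  differentiation only reaches the derivatives of \<open>u\<close>.\<close>

lemma prolong_coeff_affine_field_2:
  "prolong_coeff (affine_field A w) [i, j] p =
     - (\<Sum>k\<in>UNIV. A $ k $ j * snd p {#i, k#} + A $ k $ i * snd p {#k, j#})"
proof -
  have "total_deriv i (prolong_coeff (affine_field A w) [j]) p =
      - (\<Sum>k\<in>UNIV. A $ k $ j * snd p {#i, k#})"
    unfolding total_deriv_def jet_deriv_def prolong_coeff_affine_field_1
    by (rule DERIV_imp_deriv) (auto simp: jet_line_def mult.commute intro!: derivative_eq_intros)
  then show ?thesis
    by (simp add: total_deriv_xi_affine_field sum.distrib)
qed

lemma prolong_affine_field:
  shows "fst (prolong n (affine_field A w) p) = A *v fst p + w"
    and "snd (prolong n (affine_field A w) p) {#} = 0"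
    and "n \<ge> 1 \<Longrightarrow> snd (prolong n (affine_field A w) p) {#i#} =
           - (\<Sum>k\<in>UNIV. A $ k $ i * snd p {#k#})"
    and "n \<ge> 2 \<Longrightarrow> snd (prolong n (affine_field A w) p) {#i, j#} =
           - (\<Sum>k\<in>UNIV. A $ k $ j * snd p {#i, k#} + A $ k $ i * snd p {#k, j#})"
proof -
  show "fst (prolong n (affine_field A w) p) = A *v fst p + w"
    by (simp add: prolong_def vec_eq_iff xi_def affine_field_def)
  show "snd (prolong n (affine_field A w) p) {#} = 0"
    by (simp add: prolong_def eta_affine_field)
  show "n \<ge> 1 \<Longrightarrow> snd (prolong n (affine_field A w) p) {#i#} =
           - (\<Sum>k\<in>UNIV. A $ k $ i * snd p {#k#})"
    by (simp add: prolong_def prolong_coeff_affine_field_1 del: prolong_coeff.simps)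
  show "n \<ge> 2 \<Longrightarrow> snd (prolong n (affine_field A w) p) {#i, j#} =
           - (\<Sum>k\<in>UNIV. A $ k $ j * snd p {#i, k#} + A $ k $ i * snd p {#k, j#})"
    \<comment> \<open>The multiset may be listed as \<open>[i, j]\<close> or \<open>[j, i]\<close>,
      but the coefficient is symmetric in the two indices, so sorting does no harm.\<close>
    by (auto simp: prolong_def prolong_coeff_affine_field_2 add_mset_commute add.commute
             simp del: prolong_coeff.simps)
qed

definition heis_matrix :: "real \<Rightarrow> real \<Rightarrow> real \<Rightarrow> real^3^3" where
  "heis_matrix a b c = vector [vector [0, a, 0], vector [- a, 0, 0], vector [2 * c, - 2 * b, 0]]"

text \<open>This is the general linear combination a R + b X~ + c Y~ + d T of the four generators;
  \<open>heis_matrix\<close> holds its linear part.\<close>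

definition heis_field :: "real \<Rightarrow> real \<Rightarrow> real \<Rightarrow> real \<Rightarrow> point_field" where
  "heis_field a b c d = affine_field (heis_matrix a b c) (vector [b, c, d])"

lemma heis_field_eq:
  "heis_field a b c d =
     (\<lambda>(x, u). (vector [a * x$2 + b, - a * x$1 + c, 2 * c * x$1 - 2 * b * x$2 + d], 0))"
  by (auto simp: heis_field_def affine_field_def heis_matrix_def vec_eq_iff forall_3 sum_3
        matrix_vector_mult_def fun_eq_iff)

text \<open>The derivative of an affine field is its linear part, so the bracket is B (A x + w) - A
  (B x + v); on matrices this is the negative of the usual commutator.\<close>

lemma lie_bracket_affine_field:
  "lie_bracket (affine_field A w) (affine_field B v) =
     affine_field (B ** A - A ** B) (B *v w - A *v v)"
proof -
  have D: "frechet_derivative (affine_field A w) (at z) = (\<lambda>h. (A *v fst h, 0))" for A w z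
    unfolding affine_field_def case_prod_beta
    by (rule frechet_derivative_at[symmetric])
       (auto intro!: derivative_eq_intros bounded_linear.has_derivative[OF matrix_vector_mul_bounded_linear])
  show ?thesis
    unfolding lie_bracket_def D
    by (auto simp: affine_field_def fun_eq_iff matrix_vector_mul_assoc[symmetric]
        matrix_vector_right_distrib matrix_vector_mult_diff_rdistrib)
qed

text \<open>Encodes [R, X~] = Y~, [R, Y~] = -X~ and [X~, Y~] = 4 T, with T central. The span of the
  generators is thus closed under brackets and is the whole generated Lie algebra.\<close>

lemma lie_bracket_heis_field:
  "lie_bracket (heis_field a b c d) (heis_field a' b' c' d') =
     heis_field 0 (a' * c - a * c') (a * b' - a' * b) (4 * (b * c' - b' * c))"
  unfolding heis_field_def lie_bracket_affine_field
  by (rule arg_cong2[where f = affine_field])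
     (simp_all add: heis_matrix_def vec_eq_iff forall_3 sum_3 matrix_vector_mult_def
        matrix_matrix_mult_def algebra_simps)

lemma lie_algebra_generated_G_f:
  assumes "S \<in> lie_algebra_generated G_f"
  shows "\<exists>a b c d. S = heis_field a b c d"
  using assms
proof induction
  case (generator V)
  have "T_field = heis_field 0 0 0 1" "R_field = heis_field 1 0 0 0"
    "X_tilde = heis_field 0 1 0 0" "Y_tilde = heis_field 0 0 1 0"
    by (simp_all add: T_field_def R_field_def X_tilde_def Y_tilde_def heis_field_eq)
  with generator show ?case
    unfolding G_f_def by blast
next
  case zero
  have "(\<lambda>z. 0) = heis_field 0 0 0 0"
    by (auto simp: heis_field_eq fun_eq_iff vec_eq_iff forall_3 zero_prod_def)
  then show ?case by blast
next
  case (add V W)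
  then obtain a b c d a' b' c' d' where "V = heis_field a b c d" "W = heis_field a' b' c' d'"
    by blast
  then have "(\<lambda>z. V z + W z) = heis_field (a + a') (b + b') (c + c') (d + d')"
    by (auto simp: heis_field_eq fun_eq_iff vec_eq_iff forall_3 algebra_simps)
  then show ?case by blast
next
  case (scale V r)
  then obtain a b c d where "V = heis_field a b c d"
    by blast
  then have "(\<lambda>z. r *\<^sub>R V z) = heis_field (r * a) (r * b) (r * c) (r * d)"
    by (auto simp: heis_field_eq fun_eq_iff vec_eq_iff forall_3 algebra_simps)
  then show ?case by blast
next
  case (bracket V W)
  then show ?case using lie_bracket_heis_field by blast
qed

text \<open>Brings mixed second derivatives to the form used in
  \<open>kohn_laplacian\<close>.\<close>

lemma pair_index_sorted:
  "{#2, 1#} = {#1, 2 :: 3#}" "{#3, 1#} = {#1, 3 :: 3#}" "{#3, 2#} = {#2, 3 :: 3#}"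
  by (simp_all only: add_mset_commute)

lemma prolong_heis_field:
  fixes p :: jet
  defines "U \<equiv> snd p"
  shows "fst (prolong n (heis_field a b c d) p) =
           vector [a * fst p $ 2 + b, - a * fst p $ 1 + c,
             2 * c * fst p $ 1 - 2 * b * fst p $ 2 + d]"
    and "snd (prolong n (heis_field a b c d) p) {#} = 0"
    and "n \<ge> 1 \<Longrightarrow> snd (prolong n (heis_field a b c d) p) {#1#} = a * U {#2#} - 2 * c * U {#3#}"
    and "n \<ge> 1 \<Longrightarrow> snd (prolong n (heis_field a b c d) p) {#2#} = - a * U {#1#} + 2 * b * U {#3#}"
    and "n \<ge> 1 \<Longrightarrow> snd (prolong n (heis_field a b c d) p) {#3#} = 0"
    and "n \<ge> 2 \<Longrightarrow> snd (prolong n (heis_field a b c d) p) {#1, 1#} =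
           2 * a * U {#1, 2#} - 4 * c * U {#1, 3#}"
    and "n \<ge> 2 \<Longrightarrow> snd (prolong n (heis_field a b c d) p) {#2, 2#} =
           - 2 * a * U {#1, 2#} + 4 * b * U {#2, 3#}"
    and "n \<ge> 2 \<Longrightarrow> snd (prolong n (heis_field a b c d) p) {#3, 3#} = 0"
    and "n \<ge> 2 \<Longrightarrow> snd (prolong n (heis_field a b c d) p) {#1, 3#} =
           a * U {#2, 3#} - 2 * c * U {#3, 3#}"
    and "n \<ge> 2 \<Longrightarrow> snd (prolong n (heis_field a b c d) p) {#2, 3#} =
           - a * U {#1, 3#} + 2 * b * U {#3, 3#}"
  by (simp_all add: heis_field_def prolong_affine_field heis_matrix_def sum_3 U_def
      vec_eq_iff forall_3 matrix_vector_mult_def pair_index_sorted)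

text \<open>The operator is X^2 + Y^2 with X = d/dx + 2y d/dt and Y = d/dy - 2x d/dt. The fields T,
  X~, Y~ commute with X and Y, while R rotates this pair. The derivative therefore vanishes at every
  jet, not only on solutions.\<close>

lemma kohn_laplace_equation_invariant:
  "has_jet_deriv (kohn_laplace_equation f) (prolong 2 (heis_field a b c d) p) p 0"
  unfolding has_jet_deriv_def kohn_laplace_equation_def kohn_laplacian_def case_prod_beta jet_line_def
  by (auto simp: prolong_heis_field intro!: derivative_eq_intros)
     (simp add: algebra_simps power2_eq_square)

text \<open>The Lagrangian is ((Xu)^2 + (Yu)^2)/2 - F(u) for the same X and Y. The prolonged field
  sends Xu to a Yu and Yu to -a Xu, an infinitesimal rotation that preserves the sum of
  squares.\<close>

lemma kohn_lagrangian_invariant: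
  "has_jet_deriv (kohn_lagrangian F) (prolong 1 (heis_field a b c d) p) p 0"
  unfolding has_jet_deriv_def kohn_lagrangian_def case_prod_beta jet_line_def
  by (auto simp: prolong_heis_field intro!: derivative_eq_intros)
     (simp add: algebra_simps power2_eq_square)

lemma divergence_heis_field: "(\<Sum>i\<in>UNIV. total_deriv i (xi (heis_field a b c d) i) p) = 0"
  by (simp add: heis_field_def total_deriv_xi_affine_field heis_matrix_def sum_3)

theorem theorem1:
  fixes F f :: "real \<Rightarrow> real" and S :: point_field
  assumes "\<And>u. (F has_real_derivative f u) (at u)"
    and "S \<in> lie_algebra_generated G_f"
  shows "noether_symmetry (kohn_lagrangian F) (kohn_laplace_equation f) S"
proof -
  obtain a b c d where S: "S = heis_field a b c d"
    using lie_algebra_generated_G_f[OF assms(2)] by blast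
  have "lie_point_symmetry (kohn_laplace_equation f) S"
    unfolding lie_point_symmetry_def S
    using kohn_laplace_equation_invariant smooth_affine_field by (auto simp: heis_field_def)
  moreover have "differential_function (\<lambda>p. 0)"
    using jet_smooth_affine[of 0 0] by (auto simp: differential_function_def jet_order_le_def)
  ultimately show ?thesis
    unfolding noether_symmetry_def S
    using kohn_lagrangian_invariant
    \<comment> \<open>The first witness is the potential, the second the derivative of the
      Lagrangian along the prolonged field.\<close>
    by (intro conjI exI[of _ "\<lambda>i p. 0"] allI exI[of _ 0])
       (simp_all add: divergence_heis_field total_deriv_const del: One_nat_def)
qed

end
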